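(* Let $K$ be a compact subset of $\mathbb{R}^d$ which is Ahlfors regular. Then a typical measure $\mu\in\mathcal{P}(K)$ satisfies: for every $x\in K$, $\overline{\dim}_{\rm loc}(\mu;x)\geq\dim_{\mathcal P}(K)$.
   Context: A compact set $K\subset\mathbb{R}^d$ is Ahlfors regular if there are positive constants $s,c_1,c_2,r_0>0$ such that $\dim_{\mathcal H}(K)=s$ and $c_1r^s\leq\mathcal{H}^s(K\cap B(x,r))\leq c_2r^s$ for all $x\in K$ and all $0<r<r_0$, where $\mathcal{H}^s$ is $s$-dimensional Hausdorff measure and $\dim_{\mathcal H}$ is Hausdorff dimension. $\dim_{\mathcal P}$ is packing dimension. $\mathcal{P}(K)$ is the set of Borel probability measures on $K$, endowed with the weak topology (which is completely metrizable). A property is true for a typical measure of $\mathcal{P}(K)$ if it is satisfied by all elements of a dense $G_\delta$ subset of $\mathcal{P}(K)$. For $\mu\in\mathcal{P}(K)$ and $x\in K$, the upper local dimension is $\overline{\dim}_{\rm loc}(\mu;x)=\limsup_{r\to 0}\frac{\log\mu(B(x,r))}{\log r}$ (with $\log 0=-\infty$, so it is $+\infty$ off the support of $\mu$). *)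

theory Defs
  imports "HOL-Probability.Probability"
begin

text \<open>
  Hausdorff measure, via countable covers by sets of diameter at most \<open>\<delta>\<close>. In HOL
  \<open>0 powr 0 = 0\<close>, whereas \<open>\<H>\<^sup>0\<close> has to be counting measure; and
  \<open>diameter\<close> is meaningless on unbounded sets, so covering sets are required to be bounded.
\<close>

definition hausdorff_gauge :: "real \<Rightarrow> 'a::metric_space set \<Rightarrow> ennreal" where
  "hausdorff_gauge s U =
     (if U = {} then 0 else if s = 0 then 1 else ennreal (diameter U powr s))"

definition hausdorff_premeasure :: "real \<Rightarrow> real \<Rightarrow> 'a::metric_space set \<Rightarrow> ennreal" where
  "hausdorff_premeasure s \<delta> A =
     (INF U \<in> {U :: nat \<Rightarrow> 'a set. A \<subseteq> (\<Union>i. U i) \<and> (\<forall>i. bounded (U i) \<and> diameter (U i) \<le> \<delta>)}.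
        (\<Sum>i. hausdorff_gauge s (U i)))"

definition hausdorff_measure :: "real \<Rightarrow> 'a::metric_space set \<Rightarrow> ennreal" where
  "hausdorff_measure s A = (SUP \<delta>\<in>{0<..}. hausdorff_premeasure s \<delta> A)"

definition hausdorff_dim :: "'a::metric_space set \<Rightarrow> ereal" where
  "hausdorff_dim A = (INF s \<in> {s. 0 \<le> s \<and> hausdorff_measure s A = 0}. ereal s)"

definition ahlfors_regular :: "'a::metric_space set \<Rightarrow> bool" where
  "ahlfors_regular K \<longleftrightarrow>
     (\<exists>s c1 c2 r0 :: real. 0 < s \<and> 0 < c1 \<and> 0 < c2 \<and> 0 < r0 \<and>
        hausdorff_dim K = ereal s \<and>
        (\<forall>x\<in>K. \<forall>r. 0 < r \<and> r < r0 \<longrightarrow>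
           ennreal (c1 * r powr s) \<le> hausdorff_measure s (K \<inter> cball x r) \<and>
           hausdorff_measure s (K \<inter> cball x r) \<le> ennreal (c2 * r powr s)))"

text \<open>
  Packing measure (Tricot). A \<open>\<delta>\<close>-packing of \<open>A\<close> is given by the set of pairs
  (centre, radius) of its pairwise disjoint closed balls.
\<close>

definition packings :: "real \<Rightarrow> 'a::metric_space set \<Rightarrow> ('a \<times> real) set set" where
  "packings \<delta> A =
     {C. countable C \<and> C \<subseteq> A \<times> {0<..\<delta>} \<and> disjoint_family_on (\<lambda>(x, r). cball x r) C}"

definition packing_premeasure :: "real \<Rightarrow> 'a::metric_space set \<Rightarrow> ennreal" where
  "packing_premeasure s A =
     (INF \<delta>\<in>{0<..}. SUP C \<in> packings \<delta> A. \<Sum>\<^sub>\<infinity>(x, r)\<in>C. ennreal ((2 * r) powr s))"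

text \<open>The premeasure is not countably subadditive, hence the second step.\<close>

definition packing_measure :: "real \<Rightarrow> 'a::metric_space set \<Rightarrow> ennreal" where
  "packing_measure s A =
     (INF E \<in> {E :: nat \<Rightarrow> 'a set. A \<subseteq> (\<Union>i. E i)}. \<Sum>i. packing_premeasure s (E i))"

definition packing_dim :: "'a::metric_space set \<Rightarrow> ereal" where
  "packing_dim A = (INF s \<in> {s. 0 \<le> s \<and> packing_measure s A = 0}. ereal s)"

definition borel_prob_measures :: "'a::topological_space set \<Rightarrow> 'a measure set" where
  "borel_prob_measures K = {\<mu>. prob_space \<mu> \<and> sets \<mu> = sets (restrict_space borel K)}"

text \<open>
  The weak topology: the coarsest topology on the Borel probability measures on \<open>K\<close> making
  \<open>\<mu> \<mapsto> \<integral>f d\<mu>\<close> continuous for all bounded continuous \<open>f : K \<rightarrow> \<real>\<close>.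
\<close>

definition weak_topology :: "'a::topological_space set \<Rightarrow> 'a measure topology" where
  "weak_topology K = topology_generated_by
     {{\<mu> \<in> borel_prob_measures K. (\<integral>x. f x \<partial>\<mu>) \<in> V} | (f :: 'a \<Rightarrow> real) V.
        continuous_on K f \<and> bounded (f ` K) \<and> open V}"

definition typical_in :: "'b topology \<Rightarrow> ('b \<Rightarrow> bool) \<Rightarrow> bool" where
  "typical_in X P \<longleftrightarrow>
     (\<exists>G. gdelta_in X G \<and> X closure_of G = topspace X \<and> (\<forall>y\<in>G. P y))"

definition ereal_log :: "real \<Rightarrow> ereal" where
  "ereal_log t = (if t = 0 then -\<infinity> else ereal (ln t))"

text \<open>Intersecting with \<open>space \<mu>\<close> accounts for \<open>\<mu>\<close> being a measure on \<open>K\<close> only.\<close>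

definition upper_local_dim :: "'a::metric_space measure \<Rightarrow> 'a \<Rightarrow> ereal" where
  "upper_local_dim \<mu> x =
     Limsup (at_right 0)
       (\<lambda>r. ereal_log (measure \<mu> (cball x r \<inter> space \<mu>)) / ereal (ln r))"

end

theory Submission
  imports Defs "HOL-Real_Asymp.Real_Asymp"
begin

text \<open>
  On an Ahlfors regular compact set \<open>K\<close> of dimension \<open>s\<close>, the restriction \<open>m\<close> of \<open>\<H>\<^sup>s\<close> is a
  finite Borel measure, and comparing the balls of a packing with \<open>m\<close> gives
  \<open>packing_dim K \<le> s\<close>. It remains to see that typically the upper local dimension is at
  least \<open>s\<close> everywhere. For fixed \<open>r\<close> and \<open>c\<close>, the measures \<open>\<mu>\<close> with \<open>\<mu> (cball x r) < c\<close> for all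
  \<open>x \<in> K\<close> form a weakly open set, so the measures for which, at arbitrarily small scales \<open>r\<close>,
  all balls have mass below \<open>r powr (s - o(1))\<close> form a \<open>G\<^sub>\<delta>\<close> set. Baire's theorem is not
  needed for its density, since the set contains every measure with bounded density with respect
  to \<open>m\<close>, and averaging a given measure over small balls shows that these are dense.
\<close>

section \<open>Hausdorff measure as a Borel measure\<close>

lemma hausdorff_premeasure_mono:
  "A \<subseteq> B \<Longrightarrow> hausdorff_premeasure s \<delta> A \<le> hausdorff_premeasure s \<delta> B"
  unfolding hausdorff_premeasure_def by (rule INF_superset_mono) auto

lemma hausdorff_premeasure_antimono:
  "\<delta> \<le> \<delta>' \<Longrightarrow> hausdorff_premeasure s \<delta>' A \<le> hausdorff_premeasure s \<delta> A"
  unfolding hausdorff_premeasure_def by (rule INF_superset_mono) (auto intro: order_trans)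

lemma hausdorff_premeasure_le_measure:
  "0 < \<delta> \<Longrightarrow> hausdorff_premeasure s \<delta> A \<le> hausdorff_measure s A"
  unfolding hausdorff_measure_def by (rule SUP_upper) simp

lemma hausdorff_measure_mono: "A \<subseteq> B \<Longrightarrow> hausdorff_measure s A \<le> hausdorff_measure s B"
  unfolding hausdorff_measure_def by (intro SUP_mono) (use hausdorff_premeasure_mono in blast)

lemma hausdorff_measure_empty [simp]: "hausdorff_measure s ({} :: 'a::metric_space set) = 0"
proof -
  have "hausdorff_premeasure s \<delta> ({} :: 'a set) = 0" if "0 < \<delta>" for \<delta> :: real
  proof -
    have "hausdorff_premeasure s \<delta> ({} :: 'a set) \<le> (\<Sum>i::nat. hausdorff_gauge s ({} :: 'a set))"
      unfolding hausdorff_premeasure_def using that by (intro INF_lower2[of "\<lambda>_. {}"]) auto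
    then show ?thesis by (simp add: hausdorff_gauge_def)
  qed
  then show ?thesis
    unfolding hausdorff_measure_def by (simp add: SUP_eq_const)
qed

text \<open>Covers of the sets \<open>A i\<close> that are optimal up to
  \<open>e * (1/2)^Suc i\<close> are merged into a single cover by the pairing
  \<open>prod_decode\<close>; the errors add up to \<open>e\<close>.\<close>

lemma hausdorff_premeasure_UN_le:
  fixes A :: "nat \<Rightarrow> 'a::metric_space set"
  shows "hausdorff_premeasure s \<delta> (\<Union>i. A i) \<le> (\<Sum>i. hausdorff_premeasure s \<delta> (A i))"
proof (rule ennreal_le_epsilon)
  fix e :: real
  assume fin: "(\<Sum>i. hausdorff_premeasure s \<delta> (A i)) < top" and e: "0 < e"
  have "\<exists>U. A i \<subseteq> (\<Union>j. U j) \<and> (\<forall>j. bounded (U j) \<and> diameter (U j) \<le> \<delta>) \<and>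
      (\<Sum>j::nat. hausdorff_gauge s (U j)) \<le> hausdorff_premeasure s \<delta> (A i) + ennreal (e * (1/2)^Suc i)" for i
  proof -
    \<comment> \<open>Finiteness makes adding the error term a strict increase, so some cover lies
      below the enlarged infimum.\<close>
    have "hausdorff_premeasure s \<delta> (A i) < top"
      by (rule ennreal_suminf_lessD[OF fin])
    then have "hausdorff_premeasure s \<delta> (A i) < hausdorff_premeasure s \<delta> (A i) + ennreal (e * (1/2)^Suc i)"
      using e ennreal_add_left_cancel_less[of "hausdorff_premeasure s \<delta> (A i)" 0] by simp
    then obtain U :: "nat \<Rightarrow> 'a set" where "A i \<subseteq> (\<Union>j. U j)" "\<forall>j. bounded (U j) \<and> diameter (U j) \<le> \<delta>"
      "(\<Sum>j. hausdorff_gauge s (U j)) < hausdorff_premeasure s \<delta> (A i) + ennreal (e * (1/2)^Suc i)"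
      by (subst (asm) (1) hausdorff_premeasure_def) (auto simp: INF_less_iff)
    then show ?thesis
      by (meson less_imp_le)
  qed
  then obtain U :: "nat \<Rightarrow> nat \<Rightarrow> 'a set" where cov: "\<And>i. A i \<subseteq> (\<Union>j. U i j)"
    and diam: "\<And>i j. bounded (U i j) \<and> diameter (U i j) \<le> \<delta>"
    and le: "\<And>i. (\<Sum>j. hausdorff_gauge s (U i j)) \<le> hausdorff_premeasure s \<delta> (A i) + ennreal (e * (1/2)^Suc i)"
    by metis
  define V where "V k = (case prod_decode k of (i, j) \<Rightarrow> U i j)" for k
  have "(\<Union>i. A i) \<subseteq> (\<Union>k. V k)"
  proof
    fix x assume "x \<in> (\<Union>i. A i)"
    then obtain i j where "x \<in> U i j" using cov by blast
    then have "x \<in> V (prod_encode (i, j))" by (simp add: V_def)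
    then show "x \<in> (\<Union>k. V k)" by blast
  qed
  then have "hausdorff_premeasure s \<delta> (\<Union>i. A i) \<le> (\<Sum>k. hausdorff_gauge s (V k))"
    unfolding hausdorff_premeasure_def using diam
    by (intro INF_lower) (auto simp: V_def split: prod.split)
  also have "\<dots> = (\<Sum>i. \<Sum>j. hausdorff_gauge s (U i j))"
    using suminf_ennreal_2dimen[where f = "\<lambda>(i, j). hausdorff_gauge s (U i j)" and g = "\<lambda>i. \<Sum>j. hausdorff_gauge s (U i j)"]
    by (simp add: V_def o_def case_prod_beta)
  also have "\<dots> \<le> (\<Sum>i. hausdorff_premeasure s \<delta> (A i) + ennreal (e * (1/2)^Suc i))"
    using le by (intro suminf_le) auto
  also have "\<dots> = (\<Sum>i. hausdorff_premeasure s \<delta> (A i)) + (\<Sum>i. ennreal (e * (1/2)^Suc i))"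
    by (rule suminf_add[symmetric]) auto
  also have "(\<Sum>i. ennreal (e * (1/2)^Suc i)) = ennreal e"
    using e sums_mult[OF power_half_series, of e] by (intro suminf_ennreal_eq) auto
  finally show "hausdorff_premeasure s \<delta> (\<Union>i. A i) \<le> (\<Sum>i. hausdorff_premeasure s \<delta> (A i)) + ennreal e" .
qed

lemma hausdorff_measure_UN_le:
  fixes A :: "nat \<Rightarrow> 'a::metric_space set"
  shows "hausdorff_measure s (\<Union>i. A i) \<le> (\<Sum>i. hausdorff_measure s (A i))"
proof -
  have "hausdorff_premeasure s \<delta> (\<Union>i. A i) \<le> (\<Sum>i. hausdorff_measure s (A i))" if "0 < \<delta>" for \<delta>
    using hausdorff_premeasure_UN_le[of s \<delta> A]
    by (rule order_trans) (intro suminf_le hausdorff_premeasure_le_measure that; simp)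
  then show ?thesis
    unfolding hausdorff_measure_def[of s "\<Union>i. A i"] by (intro SUP_least) auto
qed

lemma outer_measure_space_hausdorff: "outer_measure_space UNIV (hausdorff_measure s)"
  unfolding outer_measure_space_def positive_def increasing_def countably_subadditive_def
  using hausdorff_measure_mono hausdorff_measure_UN_le by auto

lemma hausdorff_measure_Un_le:
  "hausdorff_measure s (A \<union> B) \<le> hausdorff_measure s A + hausdorff_measure s B"
proof -
  have "hausdorff_measure s (\<Union>i. binaryset A B i) \<le> (\<Sum>i. hausdorff_measure s (binaryset A B i))"
    by (rule hausdorff_measure_UN_le)
  then show ?thesis
    by (simp add: UN_binaryset_eq suminf_binaryset_eq)
qed

section \<open>Additivity on separated sets and measurability of closed sets\<close>

text \<open>A covering set of diameter below \<open>d\<close> cannot meet both \<open>A\<close> and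
  \<open>B\<close>, so every fine cover of the union splits into a cover of \<open>A\<close> and a
  cover of \<open>B\<close>.\<close>

lemma hausdorff_measure_metric:
  fixes A B :: "'a::metric_space set"
  assumes "0 < d" and sep: "\<And>x y. x \<in> A \<Longrightarrow> y \<in> B \<Longrightarrow> d \<le> dist x y"
  shows "hausdorff_measure s A + hausdorff_measure s B \<le> hausdorff_measure s (A \<union> B)"
proof -
  have sub: "hausdorff_premeasure s \<delta> A + hausdorff_premeasure s \<delta> B \<le> hausdorff_premeasure s \<delta> (A \<union> B)"
    if \<delta>: "0 < \<delta>" "\<delta> < d" for \<delta>
    unfolding hausdorff_premeasure_def[of s \<delta> "A \<union> B"]
  proof (rule INF_greatest, clarify)
    fix U :: "nat \<Rightarrow> 'a set"
    assume cov: "A \<union> B \<subseteq> (\<Union>i. U i)" and U: "\<forall>i. bounded (U i) \<and> diameter (U i) \<le> \<delta>"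
    \<comment> \<open>Sets missing \<open>C\<close> are replaced by \<open>{}\<close>, whose gauge
      is 0 even for \<open>s = 0\<close>. As each \<open>U i\<close> meets at most one of
      \<open>A\<close> and \<open>B\<close>, its gauge is charged only once.\<close>
    define part where "part C i = (if U i \<inter> C = {} then {} else U i)" for C i
    have part: "hausdorff_premeasure s \<delta> C \<le> (\<Sum>i. hausdorff_gauge s (part C i))" if "C \<subseteq> A \<union> B" for C
    proof -
      have "C \<subseteq> (\<Union>i. part C i)"
      proof
        fix x assume "x \<in> C"
        then obtain i where "x \<in> U i" using cov \<open>C \<subseteq> _\<close> by blast
        then show "x \<in> (\<Union>i. part C i)" using \<open>x \<in> C\<close> by (auto simp: part_def)
      qed
      then show ?thesis
        unfolding hausdorff_premeasure_def using U \<delta> by (intro INF_lower) (auto simp: part_def)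
    qed
    have "hausdorff_gauge s (part A i) + hausdorff_gauge s (part B i) \<le> hausdorff_gauge s (U i)" for i
    proof -
      have "U i \<inter> A = {} \<or> U i \<inter> B = {}"
      proof (rule ccontr)
        assume "\<not> ?thesis"
        then obtain x y where "x \<in> U i" "x \<in> A" "y \<in> U i" "y \<in> B" by blast
        then have "d \<le> dist x y" "dist x y \<le> \<delta>"
          using sep U diameter_bounded_bound[of "U i" x y] by (auto intro: order_trans)
        then show False using \<delta> by simp
      qed
      then show ?thesis by (auto simp: part_def hausdorff_gauge_def)
    qed
    then have "(\<Sum>i. hausdorff_gauge s (part A i)) + (\<Sum>i. hausdorff_gauge s (part B i)) \<le> (\<Sum>i. hausdorff_gauge s (U i))"
      by (subst suminf_add) (auto intro!: suminf_le)
    moreover have "hausdorff_premeasure s \<delta> A + hausdorff_premeasure s \<delta> B \<le>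
        (\<Sum>i. hausdorff_gauge s (part A i)) + (\<Sum>i. hausdorff_gauge s (part B i))"
      by (intro add_mono part) auto
    ultimately show "hausdorff_premeasure s \<delta> A + hausdorff_premeasure s \<delta> B \<le> (\<Sum>i. hausdorff_gauge s (U i))"
      by (rule order_trans[rotated])
  qed
  \<comment> \<open>The premeasures grow as \<delta> shrinks, so the two suprema can be taken along
    a common \<delta>.\<close>
  have "hausdorff_measure s A + hausdorff_measure s B =
      (SUP \<delta>\<in>{0<..}. hausdorff_premeasure s \<delta> A + hausdorff_premeasure s \<delta> B)"
    unfolding hausdorff_measure_def
  proof (rule SUP_add_directed_ennreal[symmetric])
    fix i j :: real assume "i \<in> {0<..}" "j \<in> {0<..}"
    then show "\<exists>k\<in>{0<..}. hausdorff_premeasure s i A + hausdorff_premeasure s j B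
        \<le> hausdorff_premeasure s k A + hausdorff_premeasure s k B"
      by (intro bexI[of _ "min i j"] add_mono hausdorff_premeasure_antimono) auto
  qed
  also have "\<dots> \<le> hausdorff_measure s (A \<union> B)"
  proof (rule SUP_least)
    fix \<delta> :: real assume "\<delta> \<in> {0<..}"
    define \<delta>' where "\<delta>' = min \<delta> (d/2)"
    have \<delta>': "0 < \<delta>'" "\<delta>' < d" "\<delta>' \<le> \<delta>" using \<open>\<delta> \<in> {0<..}\<close> \<open>0 < d\<close> by (auto simp: \<delta>'_def)
    have "hausdorff_premeasure s \<delta> A + hausdorff_premeasure s \<delta> B \<le>
        hausdorff_premeasure s \<delta>' A + hausdorff_premeasure s \<delta>' B"
      using \<delta>' by (intro add_mono hausdorff_premeasure_antimono)
    also have "\<dots> \<le> hausdorff_premeasure s \<delta>' (A \<union> B)" using \<delta>' sub by simp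
    also have "\<dots> \<le> hausdorff_measure s (A \<union> B)" using \<delta>'(1) by (rule hausdorff_premeasure_le_measure)
    finally show "hausdorff_premeasure s \<delta> A + hausdorff_premeasure s \<delta> B \<le> hausdorff_measure s (A \<union> B)" .
  qed
  finally show ?thesis .
qed

text \<open>Each new set keeps the distance \<open>d n\<close> from all earlier ones, which gives
  one application of additivity per step; no lower bound on \<open>d\<close> uniform in
  \<open>n\<close> is involved.\<close>

lemma hausdorff_measure_separated_sum:
  fixes R :: "nat \<Rightarrow> 'a::metric_space set"
  assumes d: "\<And>n. 0 < d n" and sep: "\<And>i n x y. i < n \<Longrightarrow> x \<in> R i \<Longrightarrow> y \<in> R n \<Longrightarrow> d n \<le> dist x y"
  shows "(\<Sum>i<n. hausdorff_measure s (R i)) \<le> hausdorff_measure s (\<Union>i<n. R i)"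
proof (induction n)
  case (Suc n)
  have "(\<Sum>i<Suc n. hausdorff_measure s (R i)) \<le> hausdorff_measure s (\<Union>i<n. R i) + hausdorff_measure s (R n)"
    using Suc by (auto intro: add_right_mono)
  also have "\<dots> \<le> hausdorff_measure s ((\<Union>i<n. R i) \<union> R n)"
    by (rule hausdorff_measure_metric[OF d[of n]]) (use sep in auto)
  also have "(\<Union>i<n. R i) \<union> R n = (\<Union>i<Suc n. R i)" by (auto simp: less_Suc_eq)
  finally show ?case .
qed simp

lemma ennreal_suminf_tail_le:
  fixes f :: "nat \<Rightarrow> ennreal"
  assumes "(\<Sum>k. f k) \<noteq> top" "0 < e"
  shows "\<exists>n. (\<Sum>k. f (k + n)) \<le> ennreal e"
proof -
  define g where "g k = enn2real (f k)" for k
  have f: "f k = ennreal (g k)" for k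
    using ennreal_suminf_lessD[of f top k] assms(1) by (simp add: g_def less_top)
  have g: "0 \<le> g k" for k by (simp add: g_def)
  have "summable g"
    using assms(1) g by (intro summable_suminf_not_top) (auto simp: f)
  then obtain n where n: "norm (\<Sum>k. g (k + n)) < e"
    using suminf_exist_split[OF assms(2) \<open>summable g\<close>] by blast
  have "(\<Sum>k. f (k + n)) = ennreal (\<Sum>k. g (k + n))"
    unfolding f using g \<open>summable g\<close> by (intro suminf_ennreal2) (auto simp: summable_iff_shift)
  then show ?thesis using n by (intro exI[of _ n]) (auto intro: ennreal_leI)
qed

text \<open>Caratheodory's argument for metric outer measures. The part \<open>E n\<close> of
  \<open>X\<close> at distance at least \<open>1 / (n + 1)\<close> from \<open>F\<close> is
  separated from \<open>X \<inter> F\<close>, so their measures add. What remains of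
  \<open>X - F\<close> lies in the shells \<open>R k\<close> with \<open>k \<ge> n\<close>; the
  measures of all shells have a finite sum, so this tail is arbitrarily small.\<close>

lemma hausdorff_measure_caratheodory_closed:
  fixes F X :: "'a::metric_space set"
  assumes "closed F"
  shows "hausdorff_measure s (X \<inter> F) + hausdorff_measure s (X - F) \<le> hausdorff_measure s X"
\<comment> \<open>\<open>infdist\<close> to the empty set is 0 by convention, so
  \<open>F = {}\<close> is treated apart; infinite measure of \<open>X\<close> is trivial.\<close>
proof (cases "F = {} \<or> hausdorff_measure s X = top")
  case True
  then show ?thesis by auto
next
  case False
  then have "F \<noteq> {}" and fin: "hausdorff_measure s X \<noteq> top" by auto
  let ?H = "hausdorff_measure s" and ?t = "\<lambda>x. infdist x F"
  define E where "E n = {x\<in>X. 1 / (real n + 1) \<le> ?t x}" for n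
  define R where "R n = {x\<in>X. 1 / (real n + 2) \<le> ?t x \<and> ?t x < 1 / (real n + 1)}" for n
  have E: "?H (X \<inter> F) + ?H (E n) \<le> ?H X" for n
  proof -
    have "?H (X \<inter> F) + ?H (E n) \<le> ?H (X \<inter> F \<union> E n)"
    proof (rule hausdorff_measure_metric)
      show "0 < 1 / (real n + 1)" by simp
      show "1 / (real n + 1) \<le> dist x y" if "x \<in> X \<inter> F" "y \<in> E n" for x y
        using that infdist_le[of x F y] by (auto simp: E_def dist_commute)
    qed
    also have "\<dots> \<le> ?H X" by (rule hausdorff_measure_mono) (auto simp: E_def)
    finally show ?thesis .
  qed
  text \<open>Distinct shells of the same parity have positive distance, so they can be summed.\<close>
  have alternate: "(\<Sum>i<n. ?H (R (2 * i + p))) \<le> ?H X" for n p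
  proof -
    have "(\<Sum>i<n. ?H (R (2 * i + p))) \<le> ?H (\<Union>i<n. R (2 * i + p))"
    proof (rule hausdorff_measure_separated_sum)
      show "0 < 1 / (2 * real n + real p + 1)^2" for n
        by (intro divide_pos_pos zero_less_power) auto
      \<comment> \<open>With \<open>q = 2 * n + p\<close>, the point \<open>x\<close> has distance
        at least \<open>1 / q\<close> from \<open>F\<close> and \<open>y\<close> less than
        \<open>1 / (q + 1)\<close>; the gap is \<open>1 / (q * (q + 1))\<close>. The smaller bound
        \<open>1 / (q + 1)^2\<close> is used because it stays positive at \<open>q = 0\<close>,
        where division by zero would give 0.\<close>
      fix i n x y assume i: "i < n" and x: "x \<in> R (2 * i + p)" and y: "y \<in> R (2 * n + p)"
      define q where "q = 2 * real n + real p"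
      have q: "q > 0" "2 * real i + real p + 2 \<le> q" using i by (auto simp: q_def)
      have "1 / (q + 1)^2 \<le> 1 / (q * (q + 1))"
        using q by (intro divide_left_mono) (auto simp: power2_eq_square)
      also have "\<dots> = 1 / q - 1 / (q + 1)"
        using q by (simp add: field_simps)
      finally have gap: "1 / (q + 1)^2 \<le> 1 / q - 1 / (q + 1)" .
      have "1 / q \<le> ?t x"
      proof -
        have "1 / q \<le> 1 / (2 * real i + real p + 2)"
          using q by (intro divide_left_mono) auto
        then show ?thesis using x by (simp add: R_def)
      qed
      moreover have "?t y \<le> 1 / (q + 1)"
        using y by (simp add: R_def q_def)
      ultimately have "1 / (q + 1)^2 \<le> dist x y"
        using gap infdist_triangle[of x F y] by linarith
      then show "1 / (2 * real n + real p + 1)^2 \<le> dist x y" by (simp add: q_def)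
    qed
    also have "\<dots> \<le> ?H X" by (rule hausdorff_measure_mono) (auto simp: R_def)
    finally show ?thesis .
  qed
  have split: "(\<Sum>k<2 * n. f k) = (\<Sum>i<n. f (2 * i + 0)) + (\<Sum>i<n. f (2 * i + 1))"
    for f :: "nat \<Rightarrow> ennreal" and n
    by (induction n) (auto simp: add_ac)
  have "(\<Sum>k. ?H (R k)) \<le> ?H X + ?H X"
  proof (rule suminf_le_const)
    fix n
    have "(\<Sum>k<n. ?H (R k)) \<le> (\<Sum>k<2 * n. ?H (R k))"
      by (rule sum_mono2) auto
    also have "\<dots> \<le> ?H X + ?H X"
      unfolding split by (intro add_mono alternate)
    finally show "(\<Sum>k<n. ?H (R k)) \<le> ?H X + ?H X" .
  qed simp
  then have total: "(\<Sum>k. ?H (R k)) \<noteq> top"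
    using fin by (auto simp: top_unique)
  have cover: "X - F \<subseteq> E n \<union> (\<Union>k. R (k + n))" for n
  proof
    fix x assume x: "x \<in> X - F"
    then have pos: "0 < ?t x"
      using \<open>closed F\<close> \<open>F \<noteq> {}\<close> infdist_pos_not_in_closed by blast
    show "x \<in> E n \<union> (\<Union>k. R (k + n))"
    proof (cases "1 / (real n + 1) \<le> ?t x")
      case True
      then show ?thesis using x by (simp add: E_def)
    next
      case False
      \<comment> \<open>Minimality of \<open>m\<close> gives the upper bound of the shell
        \<open>R m\<close>, except for \<open>m = 0\<close>, where the bound comes from
        \<open>x\<close> lying outside \<open>E n\<close>.\<close>
      define m where "m = (LEAST m. 1 / (real m + 2) \<le> ?t x)"
      obtain N where "inverse (real (Suc N)) < ?t x" using reals_Archimedean[OF pos] by blast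
      then have "1 / (real N + 2) \<le> ?t x"
        using pos by (auto simp: inverse_eq_divide field_simps)
      then have m: "1 / (real m + 2) \<le> ?t x"
        unfolding m_def by (rule LeastI)
      have "n \<le> m"
      proof (rule ccontr)
        assume "\<not> n \<le> m"
        then have "1 / (real n + 1) \<le> 1 / (real m + 2)" by (intro divide_left_mono) auto
        then show False using False m by simp
      qed
      moreover have "?t x < 1 / (real m + 1)"
      proof (cases m)
        case 0
        have "0 \<le> real n * ?t x" using pos by simp
        then show ?thesis using 0 False by (simp add: field_simps)
      next
        case (Suc j)
        then have "\<not> 1 / (real j + 2) \<le> ?t x"
          using not_less_Least[of j "\<lambda>m. 1 / (real m + 2) \<le> ?t x"] by (simp add: m_def)
        then show ?thesis using Suc by (simp add: add_ac)
      qed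
      ultimately have "x \<in> R ((m - n) + n)" using m x by (simp add: R_def)
      then show ?thesis by blast
    qed
  qed
  show ?thesis
  proof (rule ennreal_le_epsilon)
    fix e :: real assume "0 < e"
    then obtain n where n: "(\<Sum>k. ?H (R (k + n))) \<le> ennreal e"
      using ennreal_suminf_tail_le[OF total] by blast
    have "?H (X - F) \<le> ?H (E n) + ?H (\<Union>k. R (k + n))"
      using hausdorff_measure_mono[OF cover] hausdorff_measure_Un_le by (rule order_trans)
    also have "?H (\<Union>k. R (k + n)) \<le> ennreal e"
      using hausdorff_measure_UN_le n by (rule order_trans)
    finally have "?H (X \<inter> F) + ?H (X - F) \<le> ?H (X \<inter> F) + (?H (E n) + ennreal e)"
      by (simp add: add_left_mono)
    also have "\<dots> \<le> ?H X + ennreal e"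
      using E[of n] by (simp add: add.assoc[symmetric] add_right_mono)
    finally show "?H (X \<inter> F) + ?H (X - F) \<le> ?H X + ennreal e" .
  qed
qed

section \<open>The Borel measure induced by the outer measure\<close>

text \<open>\<open>measure_of\<close> keeps the given set function only if it is a measure on the
  given sigma-algebra; \<open>emeasure_hausdorff_borel\<close> establishes this.\<close>

definition hausdorff_borel :: "real \<Rightarrow> 'a::metric_space measure" where
  "hausdorff_borel s = measure_of UNIV (sets borel) (hausdorff_measure s)"

lemma sets_hausdorff_borel [simp]: "sets (hausdorff_borel s) = sets borel"
  and space_hausdorff_borel [simp]: "space (hausdorff_borel s) = UNIV"
  unfolding hausdorff_borel_def using sets.sigma_algebra_axioms[of borel]
  by (simp_all add: sigma_algebra.sigma_sets_eq sets.sigma_sets_eq[of borel, simplified])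

text \<open>The Caratheodory-measurable sets form a sigma-algebra on which the outer measure is
  countably additive. It contains the closed sets, hence all Borel sets.\<close>

lemma emeasure_hausdorff_borel:
  fixes A :: "'a::metric_space set"
  assumes "A \<in> sets borel"
  shows "emeasure (hausdorff_borel s) A = hausdorff_measure s A"
proof -
  let ?H = "hausdorff_measure s :: 'a set \<Rightarrow> ennreal"
  let ?L = "lambda_system UNIV UNIV ?H"
  interpret P: sigma_algebra UNIV "UNIV :: 'a set set"
    using sigma_algebra_Pow[of UNIV] by simp
  have ms: "measure_space UNIV ?L ?H"
    using P.caratheodory_lemma[OF outer_measure_space_hausdorff] .
  have "F \<in> ?L" if "closed F" for F
  proof -
    have "?H (X \<inter> F) + ?H (X - F) = ?H X" for X
    proof (rule antisym[OF hausdorff_measure_caratheodory_closed[OF that]])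
      show "?H X \<le> ?H (X \<inter> F) + ?H (X - F)"
        using hausdorff_measure_Un_le[of s "X \<inter> F" "X - F"] by (simp add: Int_Diff_Un)
    qed
    then show ?thesis by (simp add: P.lambda_system_eq)
  qed
  then have "sigma_sets UNIV (Collect closed) \<subseteq> ?L"
    using ms by (intro sigma_algebra.sigma_sets_subset) (auto simp: measure_space_def)
  moreover have "sets borel = sigma_sets UNIV (Collect closed :: 'a set set)"
    by (simp add: borel_eq_closed)
  ultimately have sub: "sets borel \<subseteq> ?L" by simp
  have "measure_space UNIV (sets borel) ?H"
    using ms sub sets.sigma_algebra_axioms[of "borel :: 'a measure"]
    by (auto simp: measure_space_def positive_def countably_additive_def)
  then show ?thesis
    unfolding hausdorff_borel_def using assms
    by (intro emeasure_measure_of_sigma) (auto simp: measure_space_def)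
qed

section \<open>Ahlfors regular compact sets\<close>

lemma powr_tendsto_0_at_right_0: "0 < a \<Longrightarrow> ((\<lambda>x::real. x powr a) \<longlongrightarrow> 0) (at_right 0)"
  by (rule tendsto_zero_powrI[OF tendsto_ident_at tendsto_const]) (auto simp: eventually_at_right_less eventually_at_filter)

section \<open>The reference measure \<open>m\<close> and its ball estimates\<close>

locale ahlfors_regular_compact =
  fixes K :: "'a::metric_space set" and s c1 c2 r0 :: real
  assumes compact_K: "compact K"
    and pos: "0 < c1" "0 < c2" "0 < r0"
    and lower: "\<And>x r. x \<in> K \<Longrightarrow> 0 < r \<Longrightarrow> r < r0 \<Longrightarrow> ennreal (c1 * r powr s) \<le> hausdorff_measure s (K \<inter> cball x r)"
    and upper: "\<And>x r. x \<in> K \<Longrightarrow> 0 < r \<Longrightarrow> r < r0 \<Longrightarrow> hausdorff_measure s (K \<inter> cball x r) \<le> ennreal (c2 * r powr s)"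
begin

text \<open>Restricting the space to \<open>K\<close> gives \<open>m\<close> the same sigma-algebra
  as the elements of \<open>borel_prob_measures K\<close>, so densities with respect to
  \<open>m\<close> can be elements of that set.\<close>

definition m :: "'a measure" where
  "m = restrict_space (hausdorff_borel s) K"

lemma K_borel [measurable]: "K \<in> sets borel"
  using compact_K by (simp add: borel_closed compact_imp_closed)

lemma sets_m [measurable_cong]: "sets m = sets (restrict_space borel K)"
  unfolding m_def by (rule sets_restrict_space_cong) simp

lemma space_m [simp]: "space m = K"
  by (simp add: m_def space_restrict_space)

lemma emeasure_m: "A \<in> sets borel \<Longrightarrow> A \<subseteq> K \<Longrightarrow> emeasure m A = hausdorff_measure s A"
  unfolding m_def by (subst emeasure_restrict_space) (auto simp: emeasure_hausdorff_borel)

lemma ball_sets_m [measurable, simp]: "K \<inter> cball x r \<in> sets m"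
  by (simp add: sets_m sets_restrict_space)

lemma emeasure_m_ball: "emeasure m (K \<inter> cball x r) = hausdorff_measure s (K \<inter> cball x r)"
  by (rule emeasure_m) auto

text \<open>By compactness finitely many balls of radius \<open>r0/2\<close> cover \<open>K\<close>,
  and each has finite measure by the upper regularity bound.\<close>

lemma finite_measure_m: "finite_measure m"
proof
  obtain T where T: "T \<subseteq> K" "finite T" "K \<subseteq> (\<Union>x\<in>T. ball x (r0/2))"
    using compactE_image[OF compact_K, of K "\<lambda>x. ball x (r0/2)"] pos by force
  have "emeasure m (space m) \<le> emeasure m (\<Union>x\<in>T. K \<inter> cball x (r0/2))"
    using T by (intro emeasure_mono) (force intro!: sets.finite_UN)+
  also have "\<dots> \<le> (\<Sum>x\<in>T. emeasure m (K \<inter> cball x (r0/2)))"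
    using T by (intro emeasure_subadditive_finite) auto
  also have "\<dots> \<le> (\<Sum>x\<in>T. ennreal (c2 * (r0/2) powr s))"
    using T pos by (intro sum_mono) (auto simp: emeasure_m_ball intro!: upper)
  also have "\<dots> < \<infinity>" using T by (simp add: ennreal_mult_less_top of_nat_less_top)
  finally show "emeasure m (space m) \<noteq> \<infinity>" by simp
qed

sublocale m: finite_measure m
  by (rule finite_measure_m)

lemma measure_m_lower: "x \<in> K \<Longrightarrow> 0 < r \<Longrightarrow> r < r0 \<Longrightarrow> c1 * r powr s \<le> measure m (K \<inter> cball x r)"
  using lower[of x r] by (simp add: m.emeasure_eq_measure flip: emeasure_m_ball)

lemma measure_m_upper: "x \<in> K \<Longrightarrow> 0 < r \<Longrightarrow> r < r0 \<Longrightarrow> measure m (K \<inter> cball x r) \<le> c2 * r powr s"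
  using upper[of x r] pos by (simp add: m.emeasure_eq_measure flip: emeasure_m_ball)

section \<open>Upper bound on the packing dimension\<close>

text \<open>For a ball of the packing, \<open>r powr t = r powr (t - s) * r powr s\<close> is at
  most \<open>\<delta> powr (t - s)\<close> times its mass divided by \<open>c1\<close>. The balls
  are disjoint, so their masses add up to at most the mass of \<open>K\<close>.\<close>

lemma packing_sum_le:
  assumes "s < t" "0 < \<delta>" "\<delta> < r0" and C: "C \<in> packings \<delta> K"
  shows "(\<Sum>\<^sub>\<infinity>(x, r)\<in>C. ennreal ((2 * r) powr t)) \<le> ennreal (2 powr t * measure m K / c1 * \<delta> powr (t - s))"
proof -
  \<comment> \<open>An infinite sum of nonnegative terms is the supremum of its finite partial sums,
    so finite subfamilies suffice.\<close>
  have "(\<Sum>(x, r)\<in>F. ennreal ((2 * r) powr t)) \<le> ennreal (2 powr t * measure m K / c1 * \<delta> powr (t - s))"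
    if "finite F" "F \<subseteq> C" for F
  proof -
    have summand: "(2 * r) powr t \<le> 2 powr t / c1 * \<delta> powr (t - s) * measure m (K \<inter> cball x r)"
      if "(x, r) \<in> F" for x r
    proof -
      have xr: "x \<in> K" "0 < r" "r \<le> \<delta>" using that \<open>F \<subseteq> C\<close> C by (auto simp: packings_def)
      have "(2 * r) powr t = 2 powr t / c1 * r powr (t - s) * (c1 * r powr s)"
        using xr pos by (simp add: powr_mult powr_diff)
      also have "\<dots> \<le> 2 powr t / c1 * \<delta> powr (t - s) * measure m (K \<inter> cball x r)"
        using xr assms pos measure_m_lower[of x r] by (intro mult_mono powr_mono2) auto
      finally show ?thesis .
    qed
    have "(\<Sum>(x, r)\<in>F. (2 * r) powr t) \<le> (\<Sum>(x, r)\<in>F. 2 powr t / c1 * \<delta> powr (t - s) * measure m (K \<inter> cball x r))"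
      using summand by (intro sum_mono) auto
    also have "\<dots> = 2 powr t / c1 * \<delta> powr (t - s) * (\<Sum>p\<in>F. measure m (K \<inter> (case p of (x, r) \<Rightarrow> cball x r)))"
      by (simp add: sum_distrib_left case_prod_beta)
    also have "(\<Sum>p\<in>F. measure m (K \<inter> (case p of (x, r) \<Rightarrow> cball x r))) = measure m (\<Union>p\<in>F. K \<inter> (case p of (x, r) \<Rightarrow> cball x r))"
    proof (rule m.finite_measure_finite_Union[symmetric])
      show "disjoint_family_on (\<lambda>p. K \<inter> (case p of (x, r) \<Rightarrow> cball x r)) F"
      proof (unfold disjoint_family_on_def, intro ballI impI)
        fix p q assume "p \<in> F" "q \<in> F" "p \<noteq> q"
        moreover have "disjoint_family_on (\<lambda>(x, r). cball x r) C"
          using C by (simp add: packings_def)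
        ultimately have "(case p of (x, r) \<Rightarrow> cball x r) \<inter> (case q of (x, r) \<Rightarrow> cball x r) = {}"
          using \<open>F \<subseteq> C\<close> by (auto dest: disjoint_family_onD)
        then show "(K \<inter> (case p of (x, r) \<Rightarrow> cball x r)) \<inter> (K \<inter> (case q of (x, r) \<Rightarrow> cball x r)) = {}"
          by blast
      qed
    qed (use \<open>finite F\<close> in \<open>auto split: prod.split\<close>)
    also have "2 powr t / c1 * \<delta> powr (t - s) * \<dots> \<le> 2 powr t / c1 * \<delta> powr (t - s) * measure m K"
      using pos m.bounded_measure[of "\<Union>p\<in>F. K \<inter> (case p of (x, r) \<Rightarrow> cball x r)"]
      by (intro mult_left_mono) auto
    finally have "(\<Sum>(x, r)\<in>F. (2 * r) powr t) \<le> 2 powr t * measure m K / c1 * \<delta> powr (t - s)"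
      by (simp add: mult_ac)
    moreover have "(\<Sum>(x, r)\<in>F. ennreal ((2 * r) powr t)) = ennreal (\<Sum>(x, r)\<in>F. (2 * r) powr t)"
      by (simp add: case_prod_beta)
    ultimately show ?thesis by (simp add: ennreal_leI)
  qed
  then show ?thesis
    by (subst nonneg_infsum_complete) (auto intro!: SUP_least)
qed

text \<open>The bound on packing sums carries the factor \<open>\<delta> powr (t - s)\<close>, which
  tends to 0 with \<delta>.\<close>

lemma packing_premeasure_eq_0:
  assumes "s < t"
  shows "packing_premeasure t K = 0"
proof -
  define c where "c = 2 powr t * measure m K / c1"
  have "((\<lambda>\<delta>. ennreal (c * \<delta> powr (t - s))) \<longlongrightarrow> ennreal (c * 0)) (at_right 0)"
    using assms by (intro tendsto_ennrealI tendsto_mult_left powr_tendsto_0_at_right_0) simp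
  moreover have "\<forall>\<^sub>F \<delta> in at_right 0. packing_premeasure t K \<le> ennreal (c * \<delta> powr (t - s))"
    using eventually_at_right_less[of 0] eventually_at_right_real[OF pos(3)]
  proof eventually_elim
    case (elim \<delta>)
    then show ?case
      unfolding packing_premeasure_def c_def
      by (intro INF_lower2[of \<delta>] SUP_least packing_sum_le assms) auto
  qed
  ultimately have "packing_premeasure t K \<le> ennreal (c * 0)"
    by (rule tendsto_lowerbound) simp
  then show ?thesis by simp
qed

text \<open>The constant sequence \<open>K\<close> is an admissible decomposition, and its terms
  have premeasure 0 for every exponent \<open>s + e\<close>.\<close>

lemma packing_dim_le:
  assumes "0 \<le> s"
  shows "packing_dim K \<le> ereal s"
proof (rule ereal_le_epsilon2)
  fix e :: real assume "0 < e"
  have "packing_measure (s + e) K \<le> (\<Sum>i::nat. packing_premeasure (s + e) K)"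
    unfolding packing_measure_def by (rule INF_lower) auto
  also have "\<dots> = 0" using packing_premeasure_eq_0[of "s + e"] \<open>0 < e\<close> by simp
  finally show "packing_dim K \<le> ereal s + ereal e"
    unfolding packing_dim_def plus_ereal.simps using assms \<open>0 < e\<close> by (intro INF_lower) auto
qed

end

section \<open>Weak topology\<close>

lemma space_borel_prob_measures: "\<mu> \<in> borel_prob_measures K \<Longrightarrow> space \<mu> = K"
  using sets_eq_imp_space_eq[of \<mu> "restrict_space borel K"]
  by (auto simp: borel_prob_measures_def space_restrict_space)

lemma borel_measurable_prob_measures:
  fixes f :: "'a::topological_space \<Rightarrow> real"
  assumes "\<mu> \<in> borel_prob_measures K" "continuous_on K f"
  shows "f \<in> borel_measurable \<mu>"
  using borel_measurable_continuous_on_restrict[OF assms(2)] assms(1)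
  by (subst measurable_cong_sets[of \<mu> "restrict_space borel K"]) (auto simp: borel_prob_measures_def)

lemma openin_weak_topology_integral:
  fixes f :: "'a::topological_space \<Rightarrow> real"
  assumes "continuous_on K f" "bounded (f ` K)" "open V"
  shows "openin (weak_topology K) {\<mu> \<in> borel_prob_measures K. (\<integral>x. f x \<partial>\<mu>) \<in> V}"
  unfolding weak_topology_def using assms by (intro topology_generated_by_Basis) auto

text \<open>The function 0 with \<open>V = UNIV\<close> exhibits the set of all measures as one of
  the generators.\<close>

lemma topspace_weak_topology: "topspace (weak_topology K) = borel_prob_measures K"
proof -
  have "borel_prob_measures K = {\<mu> \<in> borel_prob_measures K. (\<integral>x. (\<lambda>_. 0::real) x \<partial>\<mu>) \<in> UNIV}" by simp
  moreover have "continuous_on K (\<lambda>_. 0::real)" "bounded ((\<lambda>_. 0::real) ` K)"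
    by (auto simp: image_constant_conv)
  ultimately show ?thesis
    unfolding weak_topology_def topology_generated_by_topspace
    by (intro antisym Union_least Union_upper) blast+
qed

section \<open>Openness of uniform upper bounds on ball masses\<close>

text \<open>Continuity from above: the closed balls of radius \<open>r + 1 / (n + 1)\<close>
  decrease to the closed ball of radius \<open>r\<close>.\<close>

lemma measure_enlarged_cball_less:
  fixes K :: "'a::metric_space set"
  assumes \<mu>: "\<mu> \<in> borel_prob_measures K" and less: "measure \<mu> (K \<inter> cball x r) < c"
  shows "\<exists>\<rho>>0. measure \<mu> (K \<inter> cball x (r + \<rho>)) < c"
proof -
  interpret prob_space \<mu> using \<mu> by (simp add: borel_prob_measures_def)
  define A where "A n = K \<inter> cball x (r + 1 / (real n + 1))" for n
  have "A n \<in> sets \<mu>" for n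
    using \<mu> by (auto simp: A_def borel_prob_measures_def sets_restrict_space)
  moreover have "decseq A"
  proof (rule decseq_SucI)
    fix n
    have "1 / (real (Suc n) + 1) \<le> 1 / (real n + 1)" by (intro divide_left_mono) auto
    then show "A (Suc n) \<subseteq> A n" by (auto simp: A_def)
  qed
  ultimately have "(\<lambda>n. measure \<mu> (A n)) \<longlonglongrightarrow> measure \<mu> (\<Inter>n. A n)"
    by (intro finite_Lim_measure_decseq) auto
  moreover have "(\<Inter>n. A n) = K \<inter> cball x r"
  proof -
    have "dist x y \<le> r" if "\<And>n. dist x y \<le> r + 1 / (real n + 1)" for y
    proof (rule LIMSEQ_le_const)
      show "(\<lambda>n. r + 1 / (real n + 1)) \<longlonglongrightarrow> r"
        using tendsto_add[OF tendsto_const[of r] LIMSEQ_inverse_real_of_nat] by (simp add: inverse_eq_divide add_ac)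
    qed (use that in auto)
    moreover have "dist x y \<le> r + 1 / (real n + 1)" if "dist x y \<le> r" for y n
      using that by (rule add_increasing2[rotated]) simp
    ultimately show ?thesis by (auto simp: A_def)
  qed
  ultimately have "\<forall>\<^sub>F n in sequentially. measure \<mu> (A n) < c"
    using less by (metis order_tendstoD(2))
  then obtain n where "measure \<mu> (A n) < c" by (auto simp: eventually_sequentially)
  then show ?thesis by (intro exI[of _ "1 / (real n + 1)"]) (auto simp: A_def)
qed

text \<open>Compactness reduces the condition at all \<open>x\<close> to finitely many centres
  \<open>z\<close>: every ball of radius \<open>r\<close> centred in \<open>K\<close> lies in a
  slightly larger ball about some \<open>z\<close>. A continuous cutoff dominating the indicator of
  that larger ball turns the bound there into a weakly open condition.\<close>

lemma openin_small_balls: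
  fixes K :: "'a::metric_space set"
  assumes "compact K"
  shows "openin (weak_topology K) {\<mu> \<in> borel_prob_measures K. \<forall>x\<in>K. measure \<mu> (K \<inter> cball x r) < c}"
    (is "openin _ ?V")
proof (subst openin_subopen, rule ballI)
  fix \<mu> assume "\<mu> \<in> ?V"
  then have \<mu>: "\<mu> \<in> borel_prob_measures K" and small: "\<And>x. x \<in> K \<Longrightarrow> measure \<mu> (K \<inter> cball x r) < c" by auto
  \<comment> \<open>One \<rho> is spent on moving the centre, the other on letting the cutoff
    decrease to 0.\<close>
  have "\<exists>\<rho>>0. measure \<mu> (K \<inter> cball x (r + 2 * \<rho>)) < c" if x: "x \<in> K" for x
  proof -
    obtain \<rho> where "\<rho> > 0" "measure \<mu> (K \<inter> cball x (r + \<rho>)) < c"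
      using measure_enlarged_cball_less[OF \<mu> small[OF x]] by blast
    then show ?thesis by (intro exI[of _ "\<rho> / 2"]) auto
  qed
  then obtain \<rho> where \<rho>: "\<And>x. x \<in> K \<Longrightarrow> 0 < \<rho> x" "\<And>x. x \<in> K \<Longrightarrow> measure \<mu> (K \<inter> cball x (r + 2 * \<rho> x)) < c"
    by metis
  obtain T where T: "T \<subseteq> K" "finite T" "K \<subseteq> (\<Union>x\<in>T. ball x (\<rho> x))"
    using compactE_image[OF assms, of K "\<lambda>x. ball x (\<rho> x)"] \<rho>(1) by force
  \<comment> \<open>The cutoff is 1 up to distance \<open>r + \<rho> x\<close>, 0 from distance
    \<open>r + 2 * \<rho> x\<close> on, and linear in between.\<close>
  define f where "f x y = max 0 (min 1 ((r + 2 * \<rho> x - dist x y) / \<rho> x))" for x y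
  have cont: "continuous_on K (f x)" if "x \<in> K" for x
    unfolding f_def using \<rho>(1)[OF that] by (intro continuous_intros) auto
  have f01: "0 \<le> f x y" "f x y \<le> 1" for x y by (auto simp: f_def)
  have bdd: "bounded (f x ` K)" for x
    by (rule boundedI[of _ 1]) (use f01 in auto)
  \<comment> \<open>The first factor matters when \<open>T\<close> is empty, where the intersection
    over \<open>T\<close> is everything.\<close>
  define W where "W = borel_prob_measures K \<inter> (\<Inter>x\<in>T. {\<nu> \<in> borel_prob_measures K. (\<integral>y. f x y \<partial>\<nu>) \<in> {..<c}})"
  have int: "integrable \<nu> (f x)" if "\<nu> \<in> borel_prob_measures K" "x \<in> K" for \<nu> x
  proof -
    interpret prob_space \<nu> using that by (simp add: borel_prob_measures_def)
    show ?thesis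
      using f01 borel_measurable_prob_measures[OF that(1) cont[OF that(2)]]
      by (intro integrable_const_bound[of _ 1]) auto
  qed
  have ball_sets: "K \<inter> cball x r \<in> sets \<nu>" if "\<nu> \<in> borel_prob_measures K" for \<nu> x r
    using that by (auto simp: borel_prob_measures_def sets_restrict_space)
  have openW: "openin (weak_topology K) W"
  proof (cases "T = {}")
    case True
    then show ?thesis by (simp add: W_def flip: topspace_weak_topology)
  next
    case False
    then show ?thesis unfolding W_def using T cont bdd
      by (intro openin_Int openin_INT2 openin_weak_topology_integral)
         (auto simp flip: topspace_weak_topology)
  qed
  have ind_le: "indicator (K \<inter> cball x (r + \<rho> x)) y \<le> f x y" if "x \<in> K" for x y
  proof (cases "dist x y \<le> r + \<rho> x")
    case True
    then have "1 \<le> (r + 2 * \<rho> x - dist x y) / \<rho> x"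
      using \<rho>(1)[OF that] by (simp add: le_divide_eq)
    then have "f x y = 1" by (simp add: f_def)
    then show ?thesis by (simp add: indicator_def)
  qed (use f01 in simp)
  have le_ind: "f x y \<le> indicator (K \<inter> cball x (r + 2 * \<rho> x)) y" if "x \<in> K" "y \<in> K" for x y
  proof (cases "dist x y \<le> r + 2 * \<rho> x")
    case True
    then show ?thesis using that f01 by simp
  next
    case False
    then have "(r + 2 * \<rho> x - dist x y) / \<rho> x \<le> 0"
      using \<rho>(1)[OF that(1)] by (simp add: divide_le_0_iff)
    then have "f x y = 0" by (simp add: f_def)
    then show ?thesis by simp
  qed
  have "\<mu> \<in> W"
  proof -
    interpret prob_space \<mu> using \<mu> by (simp add: borel_prob_measures_def)
    have "(\<integral>y. f x y \<partial>\<mu>) < c" if "x \<in> T" for x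
    proof -
      have x: "x \<in> K" using that T by auto
      have "(\<integral>y. f x y \<partial>\<mu>) \<le> (\<integral>y. indicator (K \<inter> cball x (r + 2 * \<rho> x)) y \<partial>\<mu>)"
        using int[OF \<mu> x] le_ind[OF x] ball_sets[OF \<mu>] space_borel_prob_measures[OF \<mu>]
        by (intro integral_mono) (auto simp: less_top[symmetric])
      also have "\<dots> < c" using \<rho>(2)[OF x] space_borel_prob_measures[OF \<mu>] by (simp add: Int_ac)
      finally show ?thesis .
    qed
    then show ?thesis using \<mu> by (auto simp: W_def)
  qed
  moreover have "W \<subseteq> ?V"
  proof clarify
    fix \<nu> assume "\<nu> \<in> W"
    then have \<nu>: "\<nu> \<in> borel_prob_measures K" and lt: "\<And>x. x \<in> T \<Longrightarrow> (\<integral>y. f x y \<partial>\<nu>) < c"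
      by (auto simp: W_def)
    interpret prob_space \<nu> using \<nu> by (simp add: borel_prob_measures_def)
    have "measure \<nu> (K \<inter> cball x r) < c" if "x \<in> K" for x
    proof -
      obtain z where z: "z \<in> T" "dist z x < \<rho> z" using T \<open>x \<in> K\<close> by (auto simp: subset_eq)
      have zK: "z \<in> K" using z T by auto
      have "dist z y \<le> r + \<rho> z" if "dist x y \<le> r" for y
        using that z(2) dist_triangle[of z y x] by linarith
      then have "measure \<nu> (K \<inter> cball x r) \<le> measure \<nu> (K \<inter> cball z (r + \<rho> z))"
        using ball_sets[OF \<nu>] by (intro finite_measure_mono) auto
      also have "\<dots> = (\<integral>y. indicator (K \<inter> cball z (r + \<rho> z)) y \<partial>\<nu>)"
        using space_borel_prob_measures[OF \<nu>] by (simp add: Int_ac)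
      also have "\<dots> \<le> (\<integral>y. f z y \<partial>\<nu>)"
        using int[OF \<nu> zK] ind_le[OF zK] ball_sets[OF \<nu>]
        by (intro integral_mono) (auto simp: less_top[symmetric])
      finally show ?thesis using lt[OF z(1)] by simp
    qed
    then show "\<nu> \<in> borel_prob_measures K \<and> (\<forall>x\<in>K. measure \<nu> (K \<inter> cball x r) < c)" using \<nu> by simp
  qed
  ultimately show "\<exists>T. openin (weak_topology K) T \<and> \<mu> \<in> T \<and> T \<subseteq> ?V"
    using openW by blast
qed

section \<open>Approximation by measures with bounded density\<close>

lemma integral_indicator_near_const:
  fixes f :: "'a \<Rightarrow> real"
  assumes "finite_measure N" and B: "B \<in> sets N" and f: "integrable N f"
    and near: "\<And>y. y \<in> B \<Longrightarrow> \<bar>f y - c\<bar> \<le> \<eta>"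
  shows "\<bar>(\<integral>y. indicator B y * f y \<partial>N) - c * measure N B\<bar> \<le> \<eta> * measure N B"
proof -
  interpret finite_measure N by fact
  have ind: "integrable N (\<lambda>y. indicator B y * g y)" if "integrable N g" for g :: "'a \<Rightarrow> real"
    using integrable_real_mult_indicator[OF B that] by (simp add: mult.commute)
  have const: "(\<integral>y. indicator B y * b \<partial>N) = b * measure N B" for b :: real
    using B sets.sets_into_space[OF B] by (simp add: Int_absorb2 mult.commute)
  have le: "indicator B y * f y \<le> indicator B y * (c + \<eta>)" "indicator B y * (c - \<eta>) \<le> indicator B y * f y" for y
    using near[of y] by (cases "y \<in> B"; simp add: abs_le_iff)+
  have "(\<integral>y. indicator B y * f y \<partial>N) \<le> (\<integral>y. indicator B y * (c + \<eta>) \<partial>N)"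
    by (intro integral_mono ind f integrable_const le)
  moreover have "(\<integral>y. indicator B y * (c - \<eta>) \<partial>N) \<le> (\<integral>y. indicator B y * f y \<partial>N)"
    by (intro integral_mono ind f integrable_const le)
  ultimately show ?thesis unfolding const by (simp add: abs_le_iff algebra_simps)
qed

text \<open>A finite cover by balls is made disjoint. Since \<open>disjointed\<close> acts on
  sequences, the pieces are indexed by all naturals; \<open>p i\<close> is arbitrary for
  \<open>i \<ge> n\<close>, so only the earlier centres are claimed to lie in
  \<open>K\<close>.\<close>

lemma compact_finite_partition:
  fixes K :: "'a::metric_space set"
  assumes "compact K" "0 < \<epsilon>"
  obtains n :: nat and p :: "nat \<Rightarrow> 'a" and A
  where "\<And>i. i < n \<Longrightarrow> p i \<in> K" "\<And>i. A i \<in> sets (restrict_space borel K)"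
    "\<And>i. A i \<subseteq> K \<inter> cball (p i) \<epsilon>" "disjoint_family A" "(\<Union>i<n. A i) = K"
proof -
  obtain T where T: "T \<subseteq> K" "finite T" "K \<subseteq> (\<Union>x\<in>T. ball x \<epsilon>)"
    using compactE_image[OF assms(1), of K "\<lambda>x. ball x \<epsilon>"] assms(2) by force
  obtain n p where p: "T = p ` {i::nat. i < n}"
    using finite_imp_nat_seg_image_inj_on[OF T(2)] by blast
  define A where "A = disjointed (\<lambda>i. K \<inter> cball (p i) \<epsilon>)"
  have "(\<Union>i<n. A i) = (\<Union>i<n. K \<inter> cball (p i) \<epsilon>)"
    unfolding A_def using finite_UN_disjointed_eq[of "\<lambda>i. K \<inter> cball (p i) \<epsilon>" n]
    by (simp add: atLeast0LessThan)
  also have "\<dots> = K" using T(3) by (force simp: p)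
  finally have "(\<Union>i<n. A i) = K" .
  moreover have "A i \<in> sets (restrict_space borel K)" for i
  proof -
    have "range A \<subseteq> sets (restrict_space borel K)"
      unfolding A_def by (intro sets.range_disjointed_sets) (auto simp: sets_restrict_space)
    then show ?thesis by blast
  qed
  moreover have "p i \<in> K" if "i < n" for i
    using T(1) that by (auto simp: p)
  moreover have "A i \<subseteq> K \<inter> cball (p i) \<epsilon>" for i
    unfolding A_def by (rule disjointed_subset)
  moreover have "disjoint_family A"
    unfolding A_def by (rule disjoint_family_disjointed)
  ultimately show thesis
    by (intro that[of n p A]) auto
qed

context ahlfors_regular_compact
begin

text \<open>The mass that \<mu> gives to a piece \<open>A i\<close> is spread evenly, with respect
  to \<open>m\<close>, over the whole ball \<open>B i\<close> containing it. A test function varies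
  by at most \<eta> between the centre \<open>p i\<close> and any point of \<open>B i\<close>, so
  the contributions before and after spreading both differ from \<open>f (p i) * a i\<close> by at
  most \<open>\<eta> * a i\<close>.\<close>

lemma m_density_approx:
  assumes \<mu>: "\<mu> \<in> borel_prob_measures K" and "0 < \<epsilon>" "\<epsilon> < r0"
  obtains \<nu> M where "\<nu> \<in> borel_prob_measures K" "0 \<le> M"
    "\<And>S. S \<in> sets m \<Longrightarrow> measure \<nu> S \<le> M * measure m S"
    "\<And>(f :: 'a \<Rightarrow> real) \<eta>. \<lbrakk>continuous_on K f; \<And>x y. x \<in> K \<Longrightarrow> y \<in> K \<Longrightarrow> dist x y \<le> \<epsilon> \<Longrightarrow> \<bar>f x - f y\<bar> \<le> \<eta>\<rbrakk> \<Longrightarrow>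
       \<bar>(\<integral>x. f x \<partial>\<nu>) - (\<integral>x. f x \<partial>\<mu>)\<bar> \<le> 2 * \<eta>"
proof -
  interpret \<mu>: prob_space \<mu> using \<mu> by (simp add: borel_prob_measures_def)
  have sets_\<mu>: "sets \<mu> = sets m" using \<mu> by (simp add: borel_prob_measures_def sets_m)
  have space_\<mu>: "space \<mu> = K" using \<mu> by (rule space_borel_prob_measures)
  obtain n :: nat and p A where p: "\<And>i. i < n \<Longrightarrow> p i \<in> K" and A_sets: "\<And>i. A i \<in> sets m"
    and A_sub: "\<And>i. A i \<subseteq> K \<inter> cball (p i) \<epsilon>" and disj: "disjoint_family A" and UA: "(\<Union>i<n. A i) = K"
    using compact_finite_partition[OF compact_K \<open>0 < \<epsilon>\<close>] sets_m by metis
  define B where "B i = K \<inter> cball (p i) \<epsilon>" for i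
  define a where "a i = measure \<mu> (A i)" for i
  define b where "b i = measure m (B i)" for i
  have B_sets [measurable, simp]: "B i \<in> sets m" for i by (simp add: B_def)
  \<comment> \<open>This is where lower regularity enters. A piece \<open>A i\<close> may be
    \<open>m\<close>-null, so it could not serve as a normalizing set in place of
    \<open>B i\<close>.\<close>
  have b: "0 < b i" if "i < n" for i
    using measure_m_lower[OF p[OF that] assms(2,3)] assms(2) pos(1)
    by (auto simp: b_def B_def intro: less_le_trans[rotated])
  have a: "0 \<le> a i" for i by (simp add: a_def)
  have sum_a: "(\<Sum>i<n. a i) = 1"
  proof -
    have "(\<Sum>i<n. a i) = measure \<mu> (\<Union>i<n. A i)"
      unfolding a_def using A_sets disj sets_\<mu>
      by (intro \<mu>.finite_measure_finite_Union[symmetric]) (auto intro: disjoint_family_on_mono)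
    then show ?thesis using UA \<mu>.prob_space space_\<mu> by simp
  qed
  define g where "g y = (\<Sum>i<n. a i / b i * indicator (B i) y)" for y
  have g [measurable]: "g \<in> borel_measurable m" unfolding g_def by measurable
  have g0: "0 \<le> g y" for y
    unfolding g_def using a b by (intro sum_nonneg mult_nonneg_nonneg) (auto simp: less_imp_le)
  define \<nu> where "\<nu> = density m (\<lambda>y. ennreal (g y))"
  have sets_\<nu>: "sets \<nu> = sets m" and space_\<nu>: "space \<nu> = K" by (simp_all add: \<nu>_def)
  have int_B: "integrable m (\<lambda>y. indicator (B i) y * f y)" if "integrable m f" for f :: "'a \<Rightarrow> real" and i
    using integrable_real_mult_indicator[OF B_sets that] by (simp add: mult.commute)
  have int_\<nu>: "(\<integral>y. f y \<partial>\<nu>) = (\<Sum>i<n. a i / b i * (\<integral>y. indicator (B i) y * f y \<partial>m))"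
    if f: "integrable m f" for f :: "'a \<Rightarrow> real"
  proof -
    have "(\<integral>y. f y \<partial>\<nu>) = (\<integral>y. g y * f y \<partial>m)"
      unfolding \<nu>_def using f g0 by (subst integral_density) auto
    also have "\<dots> = (\<integral>y. (\<Sum>i<n. a i / b i * (indicator (B i) y * f y)) \<partial>m)"
      by (simp add: g_def sum_distrib_right mult.assoc)
    also have "\<dots> = (\<Sum>i<n. a i / b i * (\<integral>y. indicator (B i) y * f y \<partial>m))"
      using int_B[OF f] by (subst Bochner_Integration.integral_sum) auto
    finally show ?thesis .
  qed
  have close: "\<bar>(\<integral>x. f x \<partial>\<nu>) - (\<integral>x. f x \<partial>\<mu>)\<bar> \<le> 2 * \<eta>"
    if f: "continuous_on K f" and \<eta>: "\<And>x y. x \<in> K \<Longrightarrow> y \<in> K \<Longrightarrow> dist x y \<le> \<epsilon> \<Longrightarrow> \<bar>f x - f y\<bar> \<le> \<eta>"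
    for f :: "'a \<Rightarrow> real" and \<eta>
  proof -
    obtain C where C: "\<And>x. x \<in> K \<Longrightarrow> \<bar>f x\<bar> \<le> C"
      using compact_imp_bounded[OF compact_continuous_image[OF f compact_K]] by (auto simp: bounded_iff)
    have f\<mu>: "integrable \<mu> f"
      using C borel_measurable_prob_measures[OF \<mu> f] space_\<mu>
      by (intro \<mu>.integrable_const_bound[of _ C]) (auto intro!: AE_I2)
    have "f \<in> borel_measurable m"
      using borel_measurable_prob_measures[OF \<mu> f] measurable_cong_sets[OF sets_\<mu> refl] by blast
    then have fm: "integrable m f"
      using C by (intro m.integrable_const_bound[of _ C]) (auto intro!: AE_I2)
    have f\<mu>_sum: "(\<integral>x. f x \<partial>\<mu>) = (\<Sum>i<n. \<integral>x. indicator (A i) x * f x \<partial>\<mu>)"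
    proof -
      have "(\<integral>x. f x \<partial>\<mu>) = (\<integral>x. (\<Sum>i<n. indicator (A i) x * f x) \<partial>\<mu>)"
      proof (rule Bochner_Integration.integral_cong)
        fix x assume "x \<in> space \<mu>"
        then have "(1::real) = indicator (\<Union>i<n. A i) x" using UA space_\<mu> by simp
        also have "\<dots> = (\<Sum>i<n. indicator (A i) x)"
          using disj by (intro indicator_UN_disjoint) (auto intro: disjoint_family_on_mono)
        finally show "f x = (\<Sum>i<n. indicator (A i) x * f x)"
          by (simp flip: sum_distrib_right)
      qed simp
      also have "\<dots> = (\<Sum>i<n. \<integral>x. indicator (A i) x * f x \<partial>\<mu>)"
        using integrable_real_mult_indicator[OF _ f\<mu>] A_sets sets_\<mu>
        by (intro Bochner_Integration.integral_sum) (simp add: mult.commute)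
      finally show ?thesis .
    qed
    have summand: "\<bar>a i / b i * (\<integral>y. indicator (B i) y * f y \<partial>m) - (\<integral>x. indicator (A i) x * f x \<partial>\<mu>)\<bar> \<le> 2 * \<eta> * a i"
      if "i < n" for i
    proof -
      have near: "\<bar>f y - f (p i)\<bar> \<le> \<eta>" if "y \<in> B i" for y
        using that p[OF \<open>i < n\<close>] by (intro \<eta>) (auto simp: B_def dist_commute)
      let ?I = "\<integral>y. indicator (B i) y * f y \<partial>m" and ?J = "\<integral>x. indicator (A i) x * f x \<partial>\<mu>"
      have "\<bar>?I - f (p i) * b i\<bar> \<le> \<eta> * b i"
        unfolding b_def by (rule integral_indicator_near_const[OF m.finite_measure_axioms B_sets fm near])
      then have "a i / b i * \<bar>?I - f (p i) * b i\<bar> \<le> a i / b i * (\<eta> * b i)"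
        using a b[OF that] by (intro mult_left_mono) auto
      moreover have "a i / b i * \<bar>?I - f (p i) * b i\<bar> = \<bar>a i / b i * (?I - f (p i) * b i)\<bar>"
        using a[of i] b[OF that] by (simp add: abs_mult)
      moreover have "a i / b i * (?I - f (p i) * b i) = a i / b i * ?I - f (p i) * a i"
        using b[OF that] by (simp add: field_simps)
      moreover have "a i / b i * (\<eta> * b i) = \<eta> * a i" using b[OF that] by simp
      ultimately have "\<bar>a i / b i * ?I - f (p i) * a i\<bar> \<le> \<eta> * a i" by (simp only:)
      moreover have "\<bar>?J - f (p i) * a i\<bar> \<le> \<eta> * a i"
        unfolding a_def
      proof (rule integral_indicator_near_const[OF \<mu>.finite_measure_axioms _ f\<mu>])
        show "\<bar>f y - f (p i)\<bar> \<le> \<eta>" if "y \<in> A i" for y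
          using that A_sub[of i] by (intro near) (auto simp: B_def)
      qed (use A_sets sets_\<mu> in simp)
      ultimately show ?thesis by linarith
    qed
    have "\<bar>(\<integral>x. f x \<partial>\<nu>) - (\<integral>x. f x \<partial>\<mu>)\<bar> \<le>
        (\<Sum>i<n. \<bar>a i / b i * (\<integral>y. indicator (B i) y * f y \<partial>m) - (\<integral>x. indicator (A i) x * f x \<partial>\<mu>)\<bar>)"
      unfolding int_\<nu>[OF fm] f\<mu>_sum sum_subtractf[symmetric] by (rule sum_abs)
    also have "\<dots> \<le> (\<Sum>i<n. 2 * \<eta> * a i)"
      using summand by (intro sum_mono) auto
    also have "\<dots> = 2 * \<eta>" using sum_a by (simp flip: sum_distrib_left)
    finally show ?thesis .
  qed
  \<comment> \<open>The constant function 1 has oscillation 0, so its two integrals agree. A real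
    measure of 1 also rules out infinite mass, because \<open>enn2real top = 0\<close>.\<close>
  have "measure \<nu> K = 1"
    using close[of "\<lambda>_. 1" 0] \<mu>.prob_space by (simp add: space_\<nu>)
  then have "emeasure \<nu> K = 1"
    by (cases "emeasure \<nu> K") (auto simp: measure_def)
  then have prob: "prob_space \<nu>" by (intro prob_spaceI) (simp add: space_\<nu>)
  then interpret \<nu>: prob_space \<nu> .
  define M where "M = (\<Sum>i<n. a i / b i)"
  have "measure \<nu> S \<le> M * measure m S" if S: "S \<in> sets m" for S
  proof -
    have SK: "S \<subseteq> K" using sets.sets_into_space[OF S] by simp
    have "measure \<nu> S = (\<integral>y. indicator S y \<partial>\<nu>)" using SK by (simp add: space_\<nu> Int_absorb2)
    also have "\<dots> = (\<Sum>i<n. a i / b i * (\<integral>y. indicator (B i) y * indicator S y \<partial>m))"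
      using S by (intro int_\<nu>) (auto simp: less_top[symmetric])
    also have "\<dots> = (\<Sum>i<n. a i / b i * measure m (B i \<inter> S))"
      using SK by (simp add: indicator_inter_arith[symmetric] Int_absorb2 le_infI2)
    also have "\<dots> \<le> (\<Sum>i<n. a i / b i * measure m S)"
      using S a b by (intro sum_mono mult_left_mono m.finite_measure_mono) (auto simp: less_imp_le)
    finally show ?thesis by (simp add: M_def sum_distrib_right)
  qed
  moreover have "0 \<le> M" unfolding M_def using a b by (intro sum_nonneg) (auto simp: less_imp_le)
  moreover have "\<nu> \<in> borel_prob_measures K" using prob sets_\<nu> sets_m by (simp add: borel_prob_measures_def)
  ultimately show thesis using close by (intro that[of \<nu> M]) auto
qed

end

section \<open>Typical measures\<close>

text \<open>Dividing logarithms by \<open>ln r < 0\<close> reverses the inequality, so a mass below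
  \<open>r powr t\<close> makes the quotient at least \<open>t\<close>. A limsup only requires this
  at arbitrarily small scales.\<close>

lemma le_upper_local_dim:
  assumes "\<mu> \<in> borel_prob_measures K"
    and freq: "\<And>t \<delta>. t < s \<Longrightarrow> 0 < \<delta> \<Longrightarrow> \<exists>r. 0 < r \<and> r < \<delta> \<and> r < 1 \<and> measure \<mu> (K \<inter> cball x r) < r powr t"
  shows "ereal s \<le> upper_local_dim \<mu> x"
proof (rule ereal_le_epsilon2)
  fix e :: real assume "0 < e"
  let ?q = "\<lambda>r. ereal_log (measure \<mu> (cball x r \<inter> space \<mu>)) / ereal (ln r)"
  have "ereal (s - e) \<le> upper_local_dim \<mu> x"
    unfolding upper_local_dim_def
  proof (rule Limsup_greatest)
    fix P assume "\<forall>\<^sub>F r in at_right (0::real). P r"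
    then obtain \<delta> where \<delta>: "0 < \<delta>" "\<And>r. 0 < r \<Longrightarrow> r < \<delta> \<Longrightarrow> P r"
      by (auto simp: eventually_at_right_field)
    obtain r where r: "0 < r" "r < \<delta>" "r < 1" "measure \<mu> (K \<inter> cball x r) < r powr (s - e)"
      using freq[of "s - e" \<delta>] \<open>0 < e\<close> \<delta>(1) by auto
    define v where "v = measure \<mu> (cball x r \<inter> space \<mu>)"
    have v: "0 \<le> v" "v < r powr (s - e)"
      using r(4) space_borel_prob_measures[OF assms(1)] by (auto simp: v_def Int_commute)
    have "ln r < 0" using r by simp
    have "ereal (s - e) \<le> ?q r"
    proof (cases "v = 0")
      \<comment> \<open>The quotient is then minus infinity over a negative number, that is, plus
        infinity.\<close>
      case True
      then show ?thesis using \<open>ln r < 0\<close> by (simp add: ereal_log_def divide_ereal_def flip: v_def)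
    next
      case False
      then have "ln v < ln (r powr (s - e))" using v r(1) by (intro ln_less_cancel_iff[THEN iffD2]) auto
      then have "ln v < (s - e) * ln r" using r(1) by (simp add: ln_powr)
      then have "s - e \<le> ln v / ln r" using \<open>ln r < 0\<close> by (simp add: le_divide_eq)
      then show ?thesis using False \<open>ln r < 0\<close> by (simp add: ereal_log_def flip: v_def)
    qed
    also have "\<dots> \<le> (SUP r\<in>Collect P. ?q r)"
      using \<delta> r by (intro SUP_upper) auto
    finally show "ereal (s - e) \<le> (SUP r\<in>Collect P. ?q r)" .
  qed
  then show "ereal s \<le> upper_local_dim \<mu> x + ereal e"
    by (cases "upper_local_dim \<mu> x") auto
qed

text \<open>Convergence of the integrals handles the generators; finite intersections and arbitrary
  unions follow by induction on the generation of the topology.\<close>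

lemma eventually_mem_openin_weak_topology:
  fixes \<nu> :: "nat \<Rightarrow> 'a::topological_space measure"
  assumes "\<And>n. \<nu> n \<in> borel_prob_measures K"
    and lim: "\<And>f :: 'a \<Rightarrow> real. continuous_on K f \<Longrightarrow> (\<lambda>n. \<integral>x. f x \<partial>\<nu> n) \<longlonglongrightarrow> (\<integral>x. f x \<partial>\<mu>)"
    and "openin (weak_topology K) T" "\<mu> \<in> T"
  shows "\<forall>\<^sub>F n in sequentially. \<nu> n \<in> T"
  using assms(3)[unfolded weak_topology_def openin_topology_generated_by_iff] assms(4)
proof (induction rule: generate_topology_on.induct)
  case (Int S T)
  then show ?case by (auto intro: eventually_conj)
next
  case (UN \<K>)
  then obtain S where S: "S \<in> \<K>" "\<mu> \<in> S" by blast
  then have "\<forall>\<^sub>F n in sequentially. \<nu> n \<in> S" by (rule UN.IH)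
  then show ?case by (rule eventually_mono) (use S in blast)
next
  case (Basis S)
  then obtain f :: "'a \<Rightarrow> real" and V where S: "S = {\<mu> \<in> borel_prob_measures K. (\<integral>x. f x \<partial>\<mu>) \<in> V}"
    and f: "continuous_on K f" "open V" by auto
  have "\<forall>\<^sub>F n in sequentially. (\<integral>x. f x \<partial>\<nu> n) \<in> V"
    using Basis(2) S by (intro topological_tendstoD[OF lim[OF f(1)] f(2)]) auto
  then show ?case using assms(1) by (auto simp: S)
qed simp

section \<open>The dense set of measures with small balls\<close>

context ahlfors_regular_compact
begin

text \<open>The index \<open>k\<close> bounds both the scale and the loss in the exponent. The scale
  \<open>r\<close> is common to all \<open>x\<close>, so the resulting set of measures serves every
  point at once.\<close>

definition small_ball_measures :: "nat \<Rightarrow> 'a measure set" where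
  "small_ball_measures k = (\<Union>r\<in>{0<..<1 / (real k + 1)}.
     {\<mu> \<in> borel_prob_measures K. \<forall>x\<in>K. measure \<mu> (K \<inter> cball x r) < r powr (s - 1 / (real k + 1))})"

lemma gdelta_small_ball_measures: "gdelta_in (weak_topology K) (\<Inter>k. small_ball_measures k)"
  unfolding small_ball_measures_def
  by (intro gdelta_in_Inter) (auto intro!: open_imp_gdelta_in openin_Union openin_small_balls compact_K)

lemma small_ball_measures_local_dim:
  assumes \<mu>: "\<mu> \<in> (\<Inter>k. small_ball_measures k)" and x: "x \<in> K"
  shows "ereal s \<le> upper_local_dim \<mu> x"
proof (rule le_upper_local_dim)
  show "\<mu> \<in> borel_prob_measures K" using \<mu> by (auto simp: small_ball_measures_def)
  fix t \<delta> :: real assume "t < s" "0 < \<delta>"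
  \<comment> \<open>This \<open>k\<close> brings the scale below \<delta> and the exponent
    \<open>s - 1 / (k + 1)\<close> above \<open>t\<close>; as \<open>r < 1\<close>, a larger
    exponent gives a smaller power.\<close>
  then obtain k where k: "inverse (real (Suc k)) < min \<delta> (s - t)"
    using reals_Archimedean[of "min \<delta> (s - t)"] by auto
  have "\<mu> \<in> small_ball_measures k" using \<mu> by blast
  then obtain r where r: "0 < r" "r < 1 / (real k + 1)" "measure \<mu> (K \<inter> cball x r) < r powr (s - 1 / (real k + 1))"
    using x by (auto simp: small_ball_measures_def)
  have "1 / (real k + 1) \<le> 1" by simp
  then have "r < 1" using r(2) by linarith
  moreover have "r < \<delta>" using r(2) k by (simp add: inverse_eq_divide add_ac)
  moreover have "r powr (s - 1 / (real k + 1)) \<le> r powr t"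
    using k r(1) \<open>r < 1\<close> by (intro powr_mono') (auto simp: inverse_eq_divide add_ac)
  ultimately show "\<exists>r. 0 < r \<and> r < \<delta> \<and> r < 1 \<and> measure \<mu> (K \<inter> cball x r) < r powr t"
    using r by (intro exI[of _ r]) auto
qed

text \<open>Upper regularity bounds the mass of a ball by \<open>M * c2 * r powr s\<close>, which is
  \<open>r powr (s - a)\<close> times a factor tending to 0 with \<open>r\<close>.\<close>

lemma bounded_density_small_ball_measures:
  assumes \<nu>: "\<nu> \<in> borel_prob_measures K" and "0 \<le> M"
    and M: "\<And>S. S \<in> sets m \<Longrightarrow> measure \<nu> S \<le> M * measure m S"
  shows "\<nu> \<in> small_ball_measures k"
proof -
  define a where "a = 1 / (real k + 1)"
  have "0 < a" by (simp add: a_def)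
  have "((\<lambda>r. M * c2 * r powr a) \<longlongrightarrow> M * c2 * 0) (at_right 0)"
    using \<open>0 < a\<close> by (intro tendsto_mult_left powr_tendsto_0_at_right_0)
  then have "\<forall>\<^sub>F r in at_right 0. M * c2 * r powr a < 1"
    by (rule order_tendstoD) simp
  moreover have "\<forall>\<^sub>F r in at_right 0. r \<in> {0<..<min a r0}"
    using \<open>0 < a\<close> pos by (intro eventually_at_right_real) simp
  ultimately have "\<forall>\<^sub>F r in at_right 0. M * c2 * r powr a < 1 \<and> r \<in> {0<..<min a r0}"
    by (rule eventually_conj)
  then obtain r where r: "M * c2 * r powr a < 1" "0 < r" "r < a" "r < r0"
    using eventually_happens'[OF trivial_limit_at_right_real] by fastforce
  have "measure \<nu> (K \<inter> cball x r) < r powr (s - a)" if "x \<in> K" for x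
  proof -
    have "measure \<nu> (K \<inter> cball x r) \<le> M * measure m (K \<inter> cball x r)" by (rule M) simp
    also have "\<dots> \<le> M * (c2 * r powr s)"
      using that r \<open>0 \<le> M\<close> by (intro mult_left_mono measure_m_upper)
    also have "\<dots> = (M * c2 * r powr a) * r powr (s - a)"
      by (simp flip: powr_add)
    also have "\<dots> < 1 * r powr (s - a)"
      using r by (intro mult_strict_right_mono) auto
    finally show ?thesis by simp
  qed
  then show ?thesis
    unfolding small_ball_measures_def a_def[symmetric] using r \<nu> by (intro UN_I[of r]) auto
qed

text \<open>Approximants built at scales tending to 0 converge weakly to \<mu>, because continuous
  functions on the compact set \<open>K\<close> are uniformly continuous; some approximant therefore
  lies in \<open>T\<close>.\<close>

lemma small_ball_measures_dense:
  assumes \<mu>: "\<mu> \<in> borel_prob_measures K" and T: "openin (weak_topology K) T" "\<mu> \<in> T"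
  shows "\<exists>\<nu>\<in>(\<Inter>k. small_ball_measures k). \<nu> \<in> T"
proof -
  \<comment> \<open>The shift by 2 keeps the scale strictly below \<open>r0\<close> already at
    \<open>n = 0\<close>.\<close>
  define \<epsilon> where "\<epsilon> n = r0 / (real n + 2)" for n :: nat
  have \<epsilon>: "0 < \<epsilon> n" "\<epsilon> n < r0" for n using pos by (auto simp: \<epsilon>_def divide_less_eq)
  have "\<exists>\<nu>. \<nu> \<in> (\<Inter>k. small_ball_measures k) \<and> \<nu> \<in> borel_prob_measures K \<and>
      (\<forall>(f :: 'a \<Rightarrow> real) \<eta>. continuous_on K f \<longrightarrow> (\<forall>x\<in>K. \<forall>y\<in>K. dist x y \<le> \<epsilon> n \<longrightarrow> \<bar>f x - f y\<bar> \<le> \<eta>) \<longrightarrow>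
         \<bar>(\<integral>x. f x \<partial>\<nu>) - (\<integral>x. f x \<partial>\<mu>)\<bar> \<le> 2 * \<eta>)" for n
  proof -
    obtain \<nu> M where \<nu>: "\<nu> \<in> borel_prob_measures K" "0 \<le> M"
      "\<And>S. S \<in> sets m \<Longrightarrow> measure \<nu> S \<le> M * measure m S"
      and close: "\<And>(f :: 'a \<Rightarrow> real) \<eta>. \<lbrakk>continuous_on K f; \<And>x y. x \<in> K \<Longrightarrow> y \<in> K \<Longrightarrow> dist x y \<le> \<epsilon> n \<Longrightarrow> \<bar>f x - f y\<bar> \<le> \<eta>\<rbrakk> \<Longrightarrow>
         \<bar>(\<integral>x. f x \<partial>\<nu>) - (\<integral>x. f x \<partial>\<mu>)\<bar> \<le> 2 * \<eta>"
      using m_density_approx[OF \<mu> \<epsilon>] by blast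
    show ?thesis
      using bounded_density_small_ball_measures[OF \<nu>] \<nu>(1) close by (intro exI[of _ \<nu>]) blast
  qed
  then obtain \<nu> where \<nu>: "\<And>n. \<nu> n \<in> (\<Inter>k. small_ball_measures k)" "\<And>n. \<nu> n \<in> borel_prob_measures K"
    and close: "\<And>n (f :: 'a \<Rightarrow> real) \<eta>. \<lbrakk>continuous_on K f; \<forall>x\<in>K. \<forall>y\<in>K. dist x y \<le> \<epsilon> n \<longrightarrow> \<bar>f x - f y\<bar> \<le> \<eta>\<rbrakk> \<Longrightarrow>
       \<bar>(\<integral>x. f x \<partial>\<nu> n) - (\<integral>x. f x \<partial>\<mu>)\<bar> \<le> 2 * \<eta>"
    by metis
  have "\<epsilon> \<longlonglongrightarrow> 0" unfolding \<epsilon>_def by real_asymp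
  have "(\<lambda>n. \<integral>x. f x \<partial>\<nu> n) \<longlonglongrightarrow> (\<integral>x. f x \<partial>\<mu>)" if f: "continuous_on K f" for f :: "'a \<Rightarrow> real"
  proof (rule tendstoI)
    fix e :: real assume "0 < e"
    moreover have "uniformly_continuous_on K f"
      using f compact_K by (rule compact_uniformly_continuous)
    ultimately obtain d where d: "0 < d" "\<And>x y. x \<in> K \<Longrightarrow> y \<in> K \<Longrightarrow> dist x y < d \<Longrightarrow> dist (f x) (f y) < e / 3"
      by (metis uniformly_continuous_onE divide_pos_pos zero_less_numeral)
    have "\<forall>\<^sub>F n in sequentially. \<epsilon> n < d"
      using \<open>\<epsilon> \<longlonglongrightarrow> 0\<close> d(1) by (rule order_tendstoD)
    then show "\<forall>\<^sub>F n in sequentially. dist (\<integral>x. f x \<partial>\<nu> n) (\<integral>x. f x \<partial>\<mu>) < e"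
    proof eventually_elim
      case (elim n)
      have "\<bar>f x - f y\<bar> \<le> e / 3" if "x \<in> K" "y \<in> K" "dist x y \<le> \<epsilon> n" for x y
        using d(2)[OF that(1,2)] that(3) elim by (simp add: dist_real_def)
      then have "\<bar>(\<integral>x. f x \<partial>\<nu> n) - (\<integral>x. f x \<partial>\<mu>)\<bar> \<le> 2 * (e / 3)"
        by (intro close[OF f]) blast
      then show ?case using \<open>0 < e\<close> by (simp add: dist_real_def)
    qed
  qed
  then have "\<forall>\<^sub>F n in sequentially. \<nu> n \<in> T"
    by (rule eventually_mem_openin_weak_topology[OF \<nu>(2) _ T])
  then obtain n where "\<nu> n \<in> T" by (auto simp: eventually_sequentially)
  then show ?thesis using \<nu>(1) by blast
qed

end

theorem corollary1p3:
  fixes K :: "(real ^ 'd) set"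
  assumes "compact K"
    and "ahlfors_regular K"
  shows "typical_in (weak_topology K)
           (\<lambda>\<mu>. \<forall>x\<in>K. packing_dim K \<le> upper_local_dim \<mu> x)"
proof -
  obtain s c1 c2 r0 :: real where "0 < s" "0 < c1" "0 < c2" "0 < r0"
    and reg: "\<forall>x\<in>K. \<forall>r. 0 < r \<and> r < r0 \<longrightarrow>
           ennreal (c1 * r powr s) \<le> hausdorff_measure s (K \<inter> cball x r) \<and>
           hausdorff_measure s (K \<inter> cball x r) \<le> ennreal (c2 * r powr s)"
    using assms(2) unfolding ahlfors_regular_def by blast
  then interpret ahlfors_regular_compact K s c1 c2 r0
    using assms(1) by unfold_locales auto
  have "weak_topology K closure_of (\<Inter>k. small_ball_measures k) = topspace (weak_topology K)"
  proof (intro antisym closure_of_subset_topspace subsetI)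
    fix \<mu> assume "\<mu> \<in> topspace (weak_topology K)"
    then show "\<mu> \<in> weak_topology K closure_of (\<Inter>k. small_ball_measures k)"
      using small_ball_measures_dense unfolding in_closure_of topspace_weak_topology by blast
  qed
  \<comment> \<open>Both dimensions are compared with \<open>s\<close>, which separates
    them.\<close>
  moreover have "packing_dim K \<le> upper_local_dim \<mu> x" if "\<mu> \<in> (\<Inter>k. small_ball_measures k)" "x \<in> K" for \<mu> x
    using packing_dim_le small_ball_measures_local_dim[OF that] \<open>0 < s\<close> by (auto intro: order_trans)
  ultimately show ?thesis
    unfolding typical_in_def using gdelta_small_ball_measures by blast
qed

end
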